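(* Let $\tilde q_1,\dots,\tilde q_{r-1}$ be pairwise different integers such that each $|\tilde q_i|$ is an odd prime and $\tilde q_i\equiv1\pmod4$, and let $\tilde q_r\in\{8,-8\}$. Let $\alpha_i=\frac{1+\sqrt{\tilde q_i}}2$ and $\tilde\alpha_i=\frac{1-\sqrt{\tilde q_i}}2$ for $1\le i\le r-1$, and let $\alpha_r=\sqrt{\frac{\tilde q_r}4}$. Then: 1. The set $\{\alpha_1^{s_1}\cdots\alpha_r^{s_r}:(s_1,\dots,s_r)\in\{0,1\}^r\}$ is a $\mathbb Z$-basis of the ring of integers of the field $\mathbb Q(\sqrt{\tilde q_1},\dots,\sqrt{\tilde q_r})$. 2. The set $\{\tilde\alpha_1^{s_1}\alpha_1^{1-s_1}\cdots\tilde\alpha_{r-1}^{s_{r-1}}\alpha_{r-1}^{1-s_{r-1}}\alpha_r^{s_r}:(s_1,\dots,s_r)\in\{0,1\}^r\}$ is a $\mathbb Z$-basis of the ring of integers of the field $\mathbb Q(\sqrt{\tilde q_1},\dots,\sqrt{\tilde q_r})$.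
   Context: For each $i$, $\sqrt{\tilde q_i}\in\mathbb C$ denotes a fixed square root of $\tilde q_i$. The sets are understood as families indexed by $\{0,1\}^r$. *)

theory Defs
  imports Complex_Main "HOL-Library.FuncSet" "HOL-Number_Theory.Cong"
    "HOL-Algebra.Generated_Fields" "HOL-Algebra.Algebraic_Closure_Type"
begin

text \<open>
  The additive group of the complex numbers as a \<open>\<int>\<close>-module; it provides \<open>int_module.span\<close> and
  \<open>int_module.independent\<close> for integer linear combinations.
\<close>

interpretation int_module: Modules.module "\<lambda>(k :: int) (z :: complex). of_int k * z"
  by unfold_locales (simp_all add: algebra_simps)

text \<open>
  Injectivity is required because the basis is a family: \<open>int_module.independent\<close> only sees the
  image set and would ignore repeated members.
\<close>

definition is_int_basis :: "'i set \<Rightarrow> ('i \<Rightarrow> complex) \<Rightarrow> complex set \<Rightarrow> bool" where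
  "is_int_basis I b M \<longleftrightarrow>
     inj_on b I \<and> int_module.independent (b ` I) \<and> int_module.span (b ` I) = M"

text \<open>
  As every subfield of the complex numbers contains the rationals, the subfield generated by \<open>S\<close>
  is \<open>\<rat>(S)\<close>.
\<close>

definition rat_adjoin :: "complex set \<Rightarrow> complex set" where
  "rat_adjoin S = generate_field (ring_of_type_algebra :: complex ring) S"

definition ring_of_integers :: "complex set \<Rightarrow> complex set" where
  "ring_of_integers K = {x \<in> K. algebraic_int x}"

end

theory Submission
  imports Defs "Jordan_Normal_Form.Char_Poly"
begin

text \<open>
  Let \<open>K\<close> be the field generated by the square roots adjoined so far, \<open>L = K(\<surd>d)\<close> the next one, and
  write \<open>O\<close> for rings of integers. Each step of the tower has a relative integral basis: \<open>O\<^sub>L\<close> is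
  free over \<open>O\<^sub>K\<close> on \<open>1, \<alpha>\<close> or, equally well, on \<open>\<alpha>, 1 - \<alpha>\<close>, where \<open>\<alpha> = (1 + \<surd>d) / 2\<close>. Products of
  relative bases are bases, so choosing one of the two pairs at every odd step gives the two
  families of the theorem; the last step, with the square root of \<open>2\<close> or \<open>-2\<close>, has the basis
  \<open>1, \<alpha>\<^sub>r\<close> in both.

  That the relative bases exist rests on ramification: the discriminants of the quadratic fields
  are pairwise coprime. This is usually expressed by discriminants and dual bases. Here it is the
  single property \<open>unramified_at K p\<close>: an \<open>x \<in> K\<close> with \<open>p x\<^sup>2\<close> integral is itself integral. It does
  everything that is required of it:

  \<^item> It makes the extension proper: if \<open>\<surd>d \<in> K\<close>, then \<open>x = \<surd>d / d\<close> satisfies \<open>d x\<^sup>2 = 1\<close>, so \<open>x\<close> and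
    then \<open>x\<^sup>2 = 1 / d\<close> would be integral (\<open>sqrt_not_in_if_unramified\<close>).
  \<^item> It bounds denominators: if \<open>x = a + b \<alpha>\<close> is integral, then so is its conjugate \<open>x'\<close>, hence
    \<open>(x - x')\<^sup>2 = d b\<^sup>2\<close>, hence \<open>b\<close>, hence \<open>a\<close> (\<open>ring_of_integers_adjoin_odd\<close>). Unramifiedness at \<open>2\<close>
    plays the same part in the last step (\<open>ring_of_integers_adjoin_sqrt_two\<close>).
  \<^item> It passes from \<open>K\<close> to \<open>L\<close> for every \<open>p\<close> coprime to \<open>d\<close> (\<open>unramified_at_adjoin\<close>), and \<open>\<rat>\<close> has it
    at every prime.

  By induction along the tower, every prime different from the \<open>\<bar>q\<^sub>i\<bar>\<close> already used, in particular the
  next one and \<open>2\<close>, is unramified. The integers \<open>q\<^sub>i\<close> are distinct and congruent to \<open>1\<close> modulo \<open>4\<close>,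
  so no two of them differ only in sign and they are indeed pairwise coprime.
\<close>


section \<open>Algebraic integers form a ring\<close>

text \<open>
  Multiplication by \<open>x\<close> on a finitely generated subgroup is given by an integer matrix, of which \<open>x\<close>
  is an eigenvalue; so the monic integral characteristic polynomial has the root \<open>x\<close>.
\<close>

lemma algebraic_int_if_stable_span:
  fixes x b :: complex
  assumes "finite B" and stable: "\<And>v. v \<in> B \<Longrightarrow> x * v \<in> int_module.span B"
    and "b \<in> B" "b \<noteq> 0"
  shows "algebraic_int x"
proof -
  obtain vs where vs: "set vs = B" "distinct vs"
    using finite_distinct_list[OF \<open>finite B\<close>] by blast
  define n where "n = length vs"
  have "\<forall>v\<in>B. \<exists>u. x * v = (\<Sum>w\<in>B. of_int (u w) * w)"
    using stable int_module.span_finite[OF \<open>finite B\<close>] by auto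
  then obtain u where u: "\<And>v. v \<in> B \<Longrightarrow> x * v = (\<Sum>w\<in>B. of_int (u v w) * w)"
    by metis
  define A :: "int mat" where "A = mat n n (\<lambda>(i, j). u (vs ! i) (vs ! j))"
  define v :: "complex vec" where "v = vec n (\<lambda>i. vs ! i)"
  let ?A = "map_mat of_int A :: complex mat"
  have A: "A \<in> carrier_mat n n" "?A \<in> carrier_mat n n"
    by (auto simp: A_def)
  have "?A *\<^sub>v v = x \<cdot>\<^sub>v v"
  proof (rule eq_vecI)
    fix i assume "i < dim_vec (x \<cdot>\<^sub>v v)"
    hence i: "i < n" by (simp add: v_def)
    have "(?A *\<^sub>v v) $ i = (\<Sum>j<n. of_int (u (vs ! i) (vs ! j)) * vs ! j)"
      using i by (simp add: A_def v_def scalar_prod_def atLeast0LessThan)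
    also have "\<dots> = (\<Sum>w\<in>B. of_int (u (vs ! i) w) * w)"
      by (rule sum.reindex_bij_betw)
        (use vs in \<open>auto simp: n_def intro!: bij_betw_nth\<close>)
    also have "\<dots> = x * vs ! i"
      using u[of "vs ! i"] i vs nth_mem[of i vs] by (simp add: n_def)
    finally show "(?A *\<^sub>v v) $ i = (x \<cdot>\<^sub>v v) $ i"
      using i by (simp add: v_def)
  qed (simp add: v_def A_def)
  moreover have "v \<noteq> 0\<^sub>v n"
  proof
    assume "v = 0\<^sub>v n"
    moreover obtain i where "i < n" "vs ! i = b"
      using \<open>b \<in> B\<close> vs by (auto simp: n_def in_set_conv_nth)
    ultimately show False
      using \<open>b \<noteq> 0\<close> by (metis v_def index_vec index_zero_vec(1))
  qed
  ultimately have "eigenvalue ?A x"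
    unfolding eigenvalue_def eigenvector_def using A by (intro exI[of _ v]) (simp add: v_def)
  hence "poly (char_poly ?A) x = 0"
    using eigenvalue_root_char_poly[OF A(2)] by simp
  hence "poly (map_poly of_int (char_poly A)) x = 0"
    by (simp add: of_int_hom.char_poly_hom[OF A(1)])
  moreover have "lead_coeff (char_poly A) = 1"
    using degree_monic_char_poly[OF A(1)] by auto
  ultimately show ?thesis
    by (auto simp: algebraic_int_altdef_ipoly)
qed

lemma algebraic_int_powerE:
  fixes x :: complex
  assumes "algebraic_int x"
  obtains n c where "n > 0" "x ^ n = (\<Sum>k<n. of_int (c k) * x ^ k)"
proof -
  obtain p where p: "poly (map_poly of_int p) x = 0" "lead_coeff p = 1"
    using assms by (auto simp: algebraic_int_altdef_ipoly)
  define n where "n = degree p"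
  have "n > 0"
  proof (rule ccontr)
    assume "\<not> n > 0"
    then obtain c where "p = [:c:]"
      by (auto simp: n_def elim!: degree_eq_zeroE)
    thus False using p by (simp add: map_poly_pCons)
  qed
  moreover have "x ^ n = (\<Sum>k<n. of_int (- coeff p k) * x ^ k)"
  proof -
    have "0 = (\<Sum>k\<le>n. of_int (coeff p k) * x ^ k)"
      using p(1) by (simp add: poly_altdef n_def degree_map_poly coeff_map_poly)
    also have "\<dots> = x ^ n + (\<Sum>k<n. of_int (coeff p k) * x ^ k)"
      using p(2) by (simp add: n_def lessThan_Suc_atMost[symmetric])
    finally show ?thesis
      by (simp add: sum_negf eq_neg_iff_add_eq_0)
  qed
  ultimately show ?thesis by (rule that)
qed

lemma span_mult_stable:
  assumes "\<And>v. v \<in> B \<Longrightarrow> x * v \<in> int_module.span B" "w \<in> int_module.span B"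
  shows "x * w \<in> int_module.span B"
  using assms(2)
proof (induction rule: int_module.span_induct_alt)
  case (step c v w)
  have "x * (of_int c * v + w) = of_int c * (x * v) + x * w"
    by (simp add: algebra_simps)
  thus ?case
    using step assms(1) by (simp only: int_module.span_add int_module.span_scale)
qed (simp add: int_module.span_zero)

text \<open>
  The group \<open>\<int>[x, y]\<close>, spanned by the monomials with exponents below the degrees of the two
  equations. Being stable under both \<open>x\<close> and \<open>y\<close>, it is stable under their sum and product.
\<close>

lemma algebraic_ints_common_module:
  fixes x y :: complex
  assumes "algebraic_int x" "algebraic_int y"
  obtains B where "finite B" "1 \<in> B"
    "\<And>v. v \<in> B \<Longrightarrow> x * v \<in> int_module.span B" "\<And>v. v \<in> B \<Longrightarrow> y * v \<in> int_module.span B"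
proof -
  obtain n c where x: "n > 0" "x ^ n = (\<Sum>k<n. of_int (c k) * x ^ k)"
    using algebraic_int_powerE[OF assms(1)] .
  obtain m d where y: "m > 0" "y ^ m = (\<Sum>k<m. of_int (d k) * y ^ k)"
    using algebraic_int_powerE[OF assms(2)] .
  define B where "B = (\<lambda>(i, j). x ^ i * y ^ j) ` ({..<n} \<times> {..<m})"
  have B: "x ^ i * y ^ j \<in> int_module.span B" if "i < n" "j < m" for i j
    using that by (intro int_module.span_base) (auto simp: B_def)
  have "x * v \<in> int_module.span B \<and> y * v \<in> int_module.span B" if v: "v \<in> B" for v
  proof -
    obtain i j where ij: "v = x ^ i * y ^ j" "i < n" "j < m"
      using v by (auto simp: B_def)
    have "x * v \<in> int_module.span B"
    proof (cases "Suc i < n")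
      case True
      thus ?thesis using B[of "Suc i" j] ij by (simp add: mult_ac)
    next
      case False
      hence "Suc i = n" using ij by simp
      hence "x * v = x ^ n * y ^ j" using ij by (simp flip: \<open>Suc i = n\<close>)
      also have "\<dots> = (\<Sum>k<n. of_int (c k) * (x ^ k * y ^ j))"
        unfolding x(2) sum_distrib_right by (simp add: mult_ac)
      finally show ?thesis
        using B ij by (auto intro!: int_module.span_sum int_module.span_scale)
    qed
    moreover have "y * v \<in> int_module.span B"
    proof (cases "Suc j < m")
      case True
      thus ?thesis using B[of i "Suc j"] ij by (simp add: mult_ac)
    next
      case False
      hence "Suc j = m" using ij by simp
      hence "y * v = y ^ m * x ^ i" using ij by (simp flip: \<open>Suc j = m\<close>)
      also have "\<dots> = (\<Sum>k<m. of_int (d k) * (x ^ i * y ^ k))"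
        unfolding y(2) sum_distrib_right by (simp add: mult_ac)
      finally show ?thesis
        using B ij by (auto intro!: int_module.span_sum int_module.span_scale)
    qed
    ultimately show ?thesis ..
  qed
  moreover have "finite B" "1 \<in> B"
    using x(1) y(1) by (auto simp: B_def intro!: image_eqI[of _ _ "(0, 0)"])
  ultimately show ?thesis using that by blast
qed

lemma
  fixes x y :: complex
  assumes "algebraic_int x" "algebraic_int y"
  shows algebraic_int_add: "algebraic_int (x + y)"
    and algebraic_int_mult: "algebraic_int (x * y)"
proof -
  obtain B where B: "finite B" "1 \<in> B"
    "\<And>v. v \<in> B \<Longrightarrow> x * v \<in> int_module.span B" "\<And>v. v \<in> B \<Longrightarrow> y * v \<in> int_module.span B"
    using algebraic_ints_common_module[OF assms] by blast
  have "(x + y) * v \<in> int_module.span B" if "v \<in> B" for v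
    using int_module.span_add[OF B(3,4)] that by (simp add: distrib_right)
  thus "algebraic_int (x + y)"
    using B(1,2) by (intro algebraic_int_if_stable_span[of B _ 1]) auto
  have "(x * y) * v \<in> int_module.span B" if "v \<in> B" for v
    using span_mult_stable[of B x "y * v"] B that by (simp add: mult.assoc)
  thus "algebraic_int (x * y)"
    using B(1,2) by (intro algebraic_int_if_stable_span[of B _ 1]) auto
qed

lemma algebraic_int_diff:
  fixes x y :: complex
  shows "algebraic_int x \<Longrightarrow> algebraic_int y \<Longrightarrow> algebraic_int (x - y)"
  using algebraic_int_add[of x "- y"] by simp

lemma algebraic_int_square:
  fixes x :: complex
  shows "algebraic_int x \<Longrightarrow> algebraic_int (x\<^sup>2)"
  by (simp add: power2_eq_square algebraic_int_mult)

lemma algebraic_int_of_square: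
  fixes x :: complex
  assumes "algebraic_int (x\<^sup>2)"
  shows "algebraic_int x"
  by (rule algebraic_int_root[OF assms, of "monom 1 2"])
    (auto simp: poly_monom degree_monom_eq)

lemmas algebraic_int_closed =
  algebraic_int_add algebraic_int_diff algebraic_int_mult algebraic_int_square


section \<open>Quadratic extensions of subfields of the complex numbers\<close>

text \<open>
  The tower is climbed one square root at a time, so the results below concern an arbitrary subfield
  of \<open>\<complex>\<close> instead of \<open>\<rat>\<close> with a particular set adjoined.
\<close>

locale complex_subfield =
  fixes K :: "complex set"
  assumes one_closed: "1 \<in> K"
    and minus_closed: "x \<in> K \<Longrightarrow> - x \<in> K"
    and inverse_closed: "x \<in> K \<Longrightarrow> inverse x \<in> K"
    and add_closed: "x \<in> K \<Longrightarrow> y \<in> K \<Longrightarrow> x + y \<in> K"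
    and mult_closed: "x \<in> K \<Longrightarrow> y \<in> K \<Longrightarrow> x * y \<in> K"
begin

lemma diff_closed: "x \<in> K \<Longrightarrow> y \<in> K \<Longrightarrow> x - y \<in> K"
  using add_closed[of x "- y"] minus_closed[of y] by simp

lemma zero_closed: "0 \<in> K"
  using diff_closed[OF one_closed one_closed] by simp

lemma divide_closed: "x \<in> K \<Longrightarrow> y \<in> K \<Longrightarrow> x / y \<in> K"
  using mult_closed inverse_closed by (simp add: divide_inverse)

lemma power_closed: "x \<in> K \<Longrightarrow> x ^ n \<in> K"
  by (induction n) (auto intro: one_closed mult_closed)

lemma of_nat_closed: "of_nat n \<in> K"
  by (induction n) (auto intro: zero_closed one_closed add_closed)

lemma of_int_closed: "of_int n \<in> K"
  by (cases n) (auto intro: of_nat_closed minus_closed simp del: of_nat_Suc)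

lemma numeral_closed: "numeral n \<in> K"
  using of_nat_closed[of "numeral n"] by simp

lemmas closed = one_closed minus_closed inverse_closed add_closed mult_closed diff_closed
  zero_closed divide_closed power_closed of_int_closed numeral_closed

lemma Rats_subset: "\<rat> \<subseteq> K"
  by (auto elim!: Rats_cases' intro!: closed)

end

lemma ring_of_type_algebra_operations:
  fixes x y :: complex
  shows "\<one>\<^bsub>ring_of_type_algebra\<^esub> = (1 :: complex)" "\<zero>\<^bsub>ring_of_type_algebra\<^esub> = (0 :: complex)"
    "x \<oplus>\<^bsub>ring_of_type_algebra\<^esub> y = x + y" "x \<otimes>\<^bsub>ring_of_type_algebra\<^esub> y = x * y"
    "\<ominus>\<^bsub>ring_of_type_algebra\<^esub> x = - x"
    "x \<noteq> 0 \<Longrightarrow> inv\<^bsub>ring_of_type_algebra\<^esub> x = inverse x"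
proof -
  let ?R = "ring_of_type_algebra :: complex ring"
  interpret R: field ?R ..
  have R: "carrier ?R = UNIV" "\<one>\<^bsub>?R\<^esub> = 1" "\<zero>\<^bsub>?R\<^esub> = 0"
    "\<And>x y. x \<oplus>\<^bsub>?R\<^esub> y = x + y" "\<And>x y. x \<otimes>\<^bsub>?R\<^esub> y = x * y"
    by (simp_all add: ring_of_type_algebra_def)
  have minus: "\<ominus>\<^bsub>?R\<^esub> x = - x" for x
    by (rule R.minus_equality) (simp_all add: R)
  have inv: "inv\<^bsub>?R\<^esub> x = inverse x" if "x \<noteq> 0" for x
    by (rule R.comm_inv_char) (use that in \<open>simp_all add: R\<close>)
  show "\<one>\<^bsub>?R\<^esub> = 1" "\<zero>\<^bsub>?R\<^esub> = 0" "x \<oplus>\<^bsub>?R\<^esub> y = x + y" "x \<otimes>\<^bsub>?R\<^esub> y = x * y"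
    "\<ominus>\<^bsub>?R\<^esub> x = - x" "x \<noteq> 0 \<Longrightarrow> inv\<^bsub>?R\<^esub> x = inverse x"
    by (fact R minus inv)+
qed

lemma complex_subfield_rat_adjoin: "complex_subfield (rat_adjoin S)"
proof -
  note gen = generate_field.intros[where R = "ring_of_type_algebra :: complex ring" and H = S,
      unfolded ring_of_type_algebra_operations, folded rat_adjoin_def]
  have zero: "0 \<in> rat_adjoin S"
    using gen(5)[OF gen(1) gen(3)[OF gen(1)]] by simp
  show ?thesis
  proof
    show "inverse x \<in> rat_adjoin S" if "x \<in> rat_adjoin S" for x
      using gen(4)[OF that] ring_of_type_algebra_operations(6)[of x] zero by (cases "x = 0") auto
  qed (use gen in auto)
qed

lemma rat_adjoin_superset: "S \<subseteq> rat_adjoin S"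
  by (auto simp: rat_adjoin_def intro: generate_field.incl)

lemma rat_adjoin_least:
  assumes "complex_subfield K" "S \<subseteq> K"
  shows "rat_adjoin S \<subseteq> K"
proof
  interpret complex_subfield K by fact
  fix x assume "x \<in> rat_adjoin S"
  thus "x \<in> K"
    unfolding rat_adjoin_def
    by (induction rule: generate_field.induct)
      (use assms(2) in \<open>auto simp: ring_of_type_algebra_operations intro: closed\<close>)
qed

context complex_subfield
begin

definition adjoin :: "complex \<Rightarrow> complex set" where
  "adjoin s = {a + b * s | a b. a \<in> K \<and> b \<in> K}"

lemma adjoinI: "a \<in> K \<Longrightarrow> b \<in> K \<Longrightarrow> a + b * s \<in> adjoin s"
  by (auto simp: adjoin_def)

lemma adjoinE:
  assumes "x \<in> adjoin s"
  obtains a b where "a \<in> K" "b \<in> K" "x = a + b * s"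
  using assms by (auto simp: adjoin_def)

lemma adjoin_scale:
  assumes "c \<in> K" "c \<noteq> 0"
  shows "adjoin (c * s) = adjoin s"
proof (intro equalityI subsetI)
  fix x assume "x \<in> adjoin (c * s)"
  then obtain a b where "a \<in> K" "b \<in> K" "x = a + b * (c * s)" by (rule adjoinE)
  thus "x \<in> adjoin s" using adjoinI[of a "b * c" s] assms by (simp add: mult.assoc closed)
next
  fix x assume "x \<in> adjoin s"
  then obtain a b where "a \<in> K" "b \<in> K" "x = a + b * s" by (rule adjoinE)
  thus "x \<in> adjoin (c * s)"
    using adjoinI[of a "b / c" "c * s"] assms by (simp add: closed)
qed

lemma complex_subfield_adjoin:
  assumes s2: "s\<^sup>2 \<in> K"
  shows "complex_subfield (adjoin s)"
proof
  show "1 \<in> adjoin s"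
    using adjoinI[of 1 0 s] by (simp add: closed)
next
  fix x assume "x \<in> adjoin s"
  then obtain a b where x: "a \<in> K" "b \<in> K" "x = a + b * s" by (rule adjoinE)
  show "- x \<in> adjoin s"
    using adjoinI[of "- a" "- b" s] x by (simp add: closed)
  have N: "a\<^sup>2 - b\<^sup>2 * s\<^sup>2 = x * (a - b * s)"
    by (simp add: x(3) power2_eq_square algebra_simps)
  show "inverse x \<in> adjoin s"
  proof (cases "a\<^sup>2 - b\<^sup>2 * s\<^sup>2 = 0")
    case True
    with N consider "x = 0" | "a = b * s"
      by auto
    hence "x \<in> K" using x by cases (auto intro: closed)
    thus ?thesis
      using adjoinI[of "inverse x" 0 s] by (simp add: closed)
  next
    case False
    let ?N = "a\<^sup>2 - b\<^sup>2 * s\<^sup>2"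
    have "?N \<in> K" using x s2 by (auto intro!: closed)
    moreover have "inverse x = (a - b * s) / ?N"
      using False unfolding N by (auto simp: divide_simps)
    hence "inverse x = a / ?N + (- b / ?N) * s"
      by (simp add: diff_divide_distrib)
    ultimately show ?thesis
      using adjoinI[of "a / ?N" "- b / ?N" s] x by (simp add: closed)
  qed
next
  fix x y assume "x \<in> adjoin s" "y \<in> adjoin s"
  then obtain a b c d where x: "a \<in> K" "b \<in> K" "x = a + b * s"
    and y: "c \<in> K" "d \<in> K" "y = c + d * s" by (metis adjoinE)
  show "x + y \<in> adjoin s"
    using adjoinI[of "a + c" "b + d" s] x y by (simp add: closed algebra_simps)
  show "x * y \<in> adjoin s"
    using adjoinI[of "a * c + b * d * s\<^sup>2" "a * d + b * c" s] x y s2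
    by (simp add: closed algebra_simps power2_eq_square)
qed

lemma adjoin_independent:
  assumes "s \<notin> K" "a \<in> K" "b \<in> K" "a + b * s = 0"
  shows "a = 0 \<and> b = 0"
proof -
  have "b = 0"
  proof (rule ccontr)
    assume "b \<noteq> 0"
    hence "s = - a / b"
      using assms(4) by (simp add: field_simps add_eq_0_iff)
    thus False using assms closed by metis
  qed
  thus ?thesis using assms by simp
qed

text \<open>
  Evaluating an integer polynomial at \<open>a + b s\<close> gives some \<open>A + B s\<close>, and the same computation with
  \<open>-s\<close> for \<open>s\<close> gives \<open>A - B s\<close>. If the first value vanishes, then \<open>A = B = 0\<close> because \<open>s \<notin> K\<close>. This
  replaces the nontrivial automorphism of \<open>K(s)\<close> over \<open>K\<close>.
\<close>

lemma algebraic_int_conjugate: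
  assumes "s\<^sup>2 \<in> K" "s \<notin> K" "a \<in> K" "b \<in> K" "algebraic_int (a + b * s)"
  shows "algebraic_int (a - b * s)"
proof -
  have conj: "\<exists>A\<in>K. \<exists>B\<in>K. poly (map_poly of_int p) (a + b * s) = A + B * s \<and>
                     poly (map_poly of_int p) (a - b * s) = A - B * s" for p
  proof (induction p)
    case 0
    show ?case by (intro bexI[of _ 0]) (auto intro: closed)
  next
    case (pCons c p)
    then obtain A B where *: "A \<in> K" "B \<in> K" "poly (map_poly of_int p) (a + b * s) = A + B * s"
      "poly (map_poly of_int p) (a - b * s) = A - B * s" by blast
    show ?case
      using * assms pCons.hyps
      by (intro bexI[of _ "of_int c + a * A + b * B * s\<^sup>2"] bexI[of _ "a * B + b * A"])
        (auto intro!: closed simp: map_poly_pCons algebra_simps power2_eq_square)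
  qed
  obtain p where p: "poly (map_poly of_int p) (a + b * s) = 0" "lead_coeff p = 1"
    using assms(5) by (auto simp: algebraic_int_altdef_ipoly)
  obtain A B where "A \<in> K" "B \<in> K" "A + B * s = 0"
    "poly (map_poly of_int p) (a - b * s) = A - B * s"
    using conj[of p] p(1) by metis
  hence "poly (map_poly of_int p) (a - b * s) = 0"
    using adjoin_independent[OF assms(2)] by force
  thus ?thesis
    using p(2) by (auto simp: algebraic_int_altdef_ipoly)
qed

end

lemma rat_adjoin_insert:
  assumes "s\<^sup>2 \<in> rat_adjoin S"
  shows "rat_adjoin (insert s S) = complex_subfield.adjoin (rat_adjoin S) s"
proof
  interpret K: complex_subfield "rat_adjoin S" by (rule complex_subfield_rat_adjoin)
  interpret L: complex_subfield "rat_adjoin (insert s S)" by (rule complex_subfield_rat_adjoin)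
  have "S \<subseteq> K.adjoin s"
    using K.adjoinI[of _ 0 s] rat_adjoin_superset[of S] by (auto simp: K.closed)
  moreover have "s \<in> K.adjoin s"
    using K.adjoinI[of 0 1 s] by (simp add: K.closed)
  ultimately show "rat_adjoin (insert s S) \<subseteq> K.adjoin s"
    by (intro rat_adjoin_least K.complex_subfield_adjoin[OF assms]) auto
  have "rat_adjoin S \<subseteq> rat_adjoin (insert s S)"
    using rat_adjoin_superset[of "insert s S"]
    by (intro rat_adjoin_least complex_subfield_rat_adjoin) auto
  thus "K.adjoin s \<subseteq> rat_adjoin (insert s S)"
    using rat_adjoin_superset[of "insert s S"] by (auto elim!: K.adjoinE intro!: L.closed)
qed

lemma rat_adjoin_empty: "rat_adjoin {} = \<rat>"
proof
  have "complex_subfield \<rat>" by unfold_locales auto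
  thus "rat_adjoin {} \<subseteq> \<rat>" by (rule rat_adjoin_least) simp
  show "\<rat> \<subseteq> rat_adjoin {}"
    by (rule complex_subfield.Rats_subset[OF complex_subfield_rat_adjoin])
qed


section \<open>Unramified primes\<close>

text \<open>
  For a prime \<open>p\<close> and a number field \<open>K\<close> with ring of integers \<open>O\<close> this says that \<open>O / p O\<close> has no
  nilpotent elements, that is, that \<open>p\<close> does not ramify in \<open>K\<close>: with \<open>c = p x\<close>, integrality of
  \<open>p x\<^sup>2\<close> means \<open>c \<in> O\<close> and \<open>c\<^sup>2 \<in> p O\<close>, and integrality of \<open>x\<close> means \<open>c \<in> p O\<close>. Stating it for elements
  of the field avoids ideals and quotients. The sign of \<open>p\<close> is immaterial, so that \<open>p\<close> may be the
  radicand of a square root.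
\<close>

definition unramified_at :: "complex set \<Rightarrow> int \<Rightarrow> bool" where
  "unramified_at K p \<longleftrightarrow> (\<forall>x\<in>K. algebraic_int (of_int p * x\<^sup>2) \<longrightarrow> algebraic_int x)"

lemma unramified_atD:
  "unramified_at K p \<Longrightarrow> x \<in> K \<Longrightarrow> algebraic_int (of_int p * x\<^sup>2) \<Longrightarrow> algebraic_int x"
  by (auto simp: unramified_at_def)

lemma unramified_at_minus: "unramified_at K (- p) \<longleftrightarrow> unramified_at K p"
  by (simp add: unramified_at_def)

lemma unramified_at_Rats:
  assumes "prime_elem p"
  shows "unramified_at \<rat> p"
  unfolding unramified_at_def
proof (intro ballI impI)
  fix x :: complex assume x: "x \<in> \<rat>" "algebraic_int (of_int p * x\<^sup>2)"
  have "of_int p * x\<^sup>2 \<in> \<int>"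
    using x by (intro rational_algebraic_int_is_int) (auto intro!: Rats_mult Rats_power)
  then obtain k where k: "of_int p * x\<^sup>2 = of_int k" by (auto elim: Ints_cases)
  have px: "(of_int p * x)\<^sup>2 = of_int (p * k)"
    by (simp flip: k add: power2_eq_square)
  hence "algebraic_int (of_int p * x)"
    using algebraic_int_of_int[of "p * k"] algebraic_int_of_square by metis
  hence "of_int p * x \<in> \<int>"
    using x by (intro rational_algebraic_int_is_int) auto
  then obtain n where n: "of_int p * x = of_int n" by (auto elim: Ints_cases)
  have "of_int (n\<^sup>2) = (of_int (p * k) :: complex)"
    using px unfolding n by simp
  hence "p dvd n\<^sup>2"
    unfolding of_int_eq_iff by simp
  hence "p dvd n"
    using assms by (rule prime_elem_dvd_power[rotated])
  then obtain t where "n = p * t" ..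
  hence "x = of_int t"
    using n assms by auto
  thus "algebraic_int x" by simp
qed

context complex_subfield
begin

lemma sqrt_not_in_if_unramified:
  assumes "unramified_at K d" "\<not> d dvd 1" "d \<noteq> 0" "s\<^sup>2 = of_int d"
  shows "s \<notin> K"
proof
  assume "s \<in> K"
  have d: "(s / of_int d)\<^sup>2 = 1 / of_int d"
    using assms by (simp add: power_divide power2_eq_square)
  have "algebraic_int (s / of_int d)"
    using \<open>s \<in> K\<close> assms(3) by - (rule unramified_atD[OF assms(1)], auto simp: d intro: closed)
  hence "algebraic_int (1 / of_int d :: complex)"
    using algebraic_int_square d by metis
  hence "(1 / of_int d :: complex) \<in> \<int>"
    by (rule rational_algebraic_int_is_int) auto
  then obtain k where "1 / of_int d = (of_int k :: complex)" by (auto elim: Ints_cases)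
  hence "(of_int 1 :: complex) = of_int (d * k)"
    using assms(3) by (simp add: field_simps)
  hence "1 = d * k" unfolding of_int_eq_iff .
  thus False using assms(2) by (metis dvd_triv_left)
qed

end

text \<open>
  For \<open>d = 1 + 4 k\<close> the number \<open>\<alpha> = (1 + \<surd>d) / 2\<close> is a root of \<open>X\<^sup>2 - X - k\<close>.
\<close>

lemma algebraic_int_half_one_plus_sqrt:
  fixes s :: complex
  assumes "s\<^sup>2 = of_int d" "[d = 1] (mod 4)"
  shows "algebraic_int ((1 + s) / 2)"
proof -
  obtain k where k: "d - 1 = 4 * k"
    using assms(2) by (metis cong_iff_dvd_diff dvdE)
  define \<alpha> where "\<alpha> = (1 + s) / 2"
  have "\<alpha> * \<alpha> - \<alpha> = (s\<^sup>2 - 1) / 4"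
    by (simp add: \<alpha>_def power2_eq_square field_simps)
  also have "\<dots> = of_int (d - 1) / 4"
    using assms(1) by simp
  also have "\<dots> = of_int k"
    unfolding k by simp
  finally have "poly [:0, -1, 1:] \<alpha> = of_int k"
    by (simp add: right_diff_distrib)
  moreover have "\<forall>i. coeff [:0, -1, 1 :: complex:] i \<in> \<int>"
    by (auto simp: coeff_pCons split: nat.splits)
  ultimately show ?thesis
    unfolding \<alpha>_def[symmetric]
    by (rule algebraic_int_root[OF algebraic_int_of_int]) auto
qed

context complex_subfield
begin

text \<open>
  Write \<open>x = c + e \<alpha>\<close> with \<open>\<alpha> = (1 + \<surd>d) / 2\<close>, and let \<open>x'\<close> be its conjugate. From \<open>p x\<^sup>2\<close> and
  \<open>p x'\<^sup>2\<close> one gets \<open>p x x'\<close>, and then \<open>p (x - x')\<^sup>2 = p d e\<^sup>2\<close>, as integral elements. The last one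
  equals both \<open>d (p e)\<^sup>2 / p\<close> and \<open>p (d e)\<^sup>2 / d\<close>, so unramifiedness of \<open>K\<close> at \<open>d\<close> makes \<open>p e\<close> integral,
  unramifiedness at \<open>p\<close> makes \<open>d e\<close> integral, and Bezout's identity for \<open>p\<close> and \<open>d\<close> yields \<open>e\<close>
  itself. Then \<open>p c\<^sup>2\<close> is integral, and so is \<open>c\<close>. As no step divides by \<open>2\<close>, the case \<open>p = 2\<close>, on
  which the last square root of the tower depends, is covered.
\<close>

lemma unramified_at_adjoin:
  assumes d: "unramified_at K d" and p: "unramified_at K p" and "coprime p d"
    and s: "s\<^sup>2 = of_int d" "s \<notin> K" and "[d = 1] (mod 4)"
  shows "unramified_at (adjoin s) p"
  unfolding unramified_at_def
proof (intro ballI impI)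
  let ?p = "of_int p :: complex" and ?d = "of_int d :: complex"
  fix x assume "x \<in> adjoin s" and px2: "algebraic_int (?p * x\<^sup>2)"
  then obtain a b where ab: "a \<in> K" "b \<in> K" "x = a + b * s" by (metis adjoinE)
  define x' where "x' = a - b * s"
  define \<alpha> where "\<alpha> = (1 + s) / 2"
  define e where "e = 2 * b"
  have \<alpha>: "algebraic_int \<alpha>"
    unfolding \<alpha>_def using s(1) assms(6) by (rule algebraic_int_half_one_plus_sqrt)
  have eK: "e \<in> K" using ab by (auto simp: e_def intro: closed)
  have "?p * x\<^sup>2 = ?p * (a\<^sup>2 + b\<^sup>2 * ?d) + 2 * ?p * a * b * s"
    by (simp add: ab flip: s(1)) (simp add: power2_eq_square algebra_simps)
  hence "algebraic_int (?p * (a\<^sup>2 + b\<^sup>2 * ?d) - 2 * ?p * a * b * s)"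
    using px2 ab s by (intro algebraic_int_conjugate) (auto intro!: closed)
  also have "?p * (a\<^sup>2 + b\<^sup>2 * ?d) - 2 * ?p * a * b * s = ?p * x'\<^sup>2"
    by (simp add: x'_def flip: s(1)) (simp add: power2_eq_square algebra_simps)
  finally have px'2: "algebraic_int (?p * x'\<^sup>2)" .
  have "(?p * (x * x'))\<^sup>2 = ?p * x\<^sup>2 * (?p * x'\<^sup>2)"
    by (simp add: power2_eq_square)
  hence norm: "algebraic_int (?p * (x * x'))"
    using algebraic_int_mult[OF px2 px'2] by - (rule algebraic_int_of_square, simp)
  have "?p * ?d * e\<^sup>2 = ?p * x\<^sup>2 + ?p * x'\<^sup>2 - 2 * (?p * (x * x'))"
    by (simp add: ab x'_def e_def flip: s(1)) (simp add: power2_eq_square algebra_simps)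
  hence pde: "algebraic_int (?p * ?d * e\<^sup>2)"
    by (simp only: algebraic_int_closed px2 px'2 norm algebraic_int_numeral)
  have "algebraic_int (?p * e)"
  proof (rule unramified_atD[OF d])
    have "?d * (?p * e)\<^sup>2 = ?p * (?p * ?d * e\<^sup>2)"
      by (simp add: power2_eq_square)
    thus "algebraic_int (?d * (?p * e)\<^sup>2)"
      by (simp only: algebraic_int_closed pde algebraic_int_of_int)
  qed (auto intro: closed eK)
  moreover have "algebraic_int (?d * e)"
  proof (rule unramified_atD[OF p])
    have "?p * (?d * e)\<^sup>2 = ?d * (?p * ?d * e\<^sup>2)"
      by (simp add: power2_eq_square)
    thus "algebraic_int (?p * (?d * e)\<^sup>2)"
      by (simp only: algebraic_int_closed pde algebraic_int_of_int)
  qed (auto intro: closed eK)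
  moreover obtain u v where "u * p + v * d = 1"
    using bezout_int[of p d] \<open>coprime p d\<close> by (metis coprime_iff_gcd_eq_1)
  hence "of_int (u * p + v * d) = (1 :: complex)" by (simp only: of_int_1)
  hence "e = of_int u * (?p * e) + of_int v * (?d * e)"
    by (metis (no_types, lifting) distrib_right mult.assoc mult_1 of_int_add of_int_mult)
  ultimately have e: "algebraic_int e"
    by (metis algebraic_int_closed(1,3) algebraic_int_of_int)
  have "(?p * x)\<^sup>2 = ?p * (?p * x\<^sup>2)"
    by (simp add: power2_eq_square)
  hence px: "algebraic_int (?p * x)"
    by - (rule algebraic_int_of_square, simp only: algebraic_int_closed px2 algebraic_int_of_int)
  define c where "c = x - e * \<alpha>"
  have "algebraic_int c"
  proof (rule unramified_atD[OF p])
    have "c = a - b"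
      by (simp add: c_def e_def \<alpha>_def ab algebra_simps)
    thus "c \<in> K" using ab by (simp add: closed)
    have "?p * c\<^sup>2 = ?p * x\<^sup>2 - 2 * (?p * x * (e * \<alpha>)) + ?p * (e\<^sup>2 * \<alpha>\<^sup>2)"
      by (simp add: c_def power2_eq_square algebra_simps)
    thus "algebraic_int (?p * c\<^sup>2)"
      by (simp only: algebraic_int_closed px2 px e \<alpha> algebraic_int_of_int algebraic_int_numeral)
  qed
  hence "algebraic_int (c + e * \<alpha>)"
    by (simp only: algebraic_int_closed e \<alpha>)
  thus "algebraic_int x" by (simp add: c_def)
qed


section \<open>Relative integral bases\<close>

lemma ring_of_integers_adjoin_odd:
  assumes d: "unramified_at K d" and s: "s\<^sup>2 = of_int d" "s \<notin> K" and "[d = 1] (mod 4)"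
  shows "ring_of_integers (adjoin s) =
    {a + b * ((1 + s) / 2) | a b. a \<in> ring_of_integers K \<and> b \<in> ring_of_integers K}"
proof -
  define \<alpha> where "\<alpha> = (1 + s) / 2"
  have \<alpha>: "algebraic_int \<alpha>"
    unfolding \<alpha>_def using s(1) assms(4) by (rule algebraic_int_half_one_plus_sqrt)
  have "\<exists>a b. x = a + b * \<alpha> \<and> a \<in> ring_of_integers K \<and> b \<in> ring_of_integers K"
    if x: "x \<in> adjoin s" "algebraic_int x" for x
  proof -
    obtain a b where ab: "a \<in> K" "b \<in> K" "x = a + b * s"
      using x(1) by (rule adjoinE)
    have "algebraic_int (a - b * s)"
      using x ab s by (intro algebraic_int_conjugate) (auto intro: closed)
    hence "algebraic_int (x - (a - b * s))"
      by (rule algebraic_int_diff[OF x(2)])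
    hence "algebraic_int ((x - (a - b * s))\<^sup>2)"
      by (rule algebraic_int_square)
    also have "(x - (a - b * s))\<^sup>2 = of_int d * (2 * b)\<^sup>2"
      by (simp add: ab flip: s(1)) (simp add: power2_eq_square)
    finally have b: "algebraic_int (2 * b)"
      using ab by - (rule unramified_atD[OF d], auto intro: closed)
    \<comment> \<open>the coordinates with respect to \<open>1, s\<close> and to \<open>1, \<alpha>\<close> are related by \<open>s = 2 \<alpha> - 1\<close>\<close>
    have eq: "x = (a - b) + 2 * b * \<alpha>"
      by (simp add: ab \<alpha>_def algebra_simps)
    hence "a - b = x - 2 * b * \<alpha>" by simp
    hence "algebraic_int (a - b)"
      by (simp only: algebraic_int_closed b x \<alpha>)
    thus ?thesis
      using eq b ab by (intro exI[of _ "a - b"] exI[of _ "2 * b"])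
        (simp add: ring_of_integers_def closed)
  qed
  moreover have "a + b * \<alpha> \<in> adjoin s" if "a \<in> K" "b \<in> K" for a b
    using adjoinI[of "a + b / 2" "b / 2" s] that
    by (simp add: closed \<alpha>_def add_divide_distrib algebra_simps)
  ultimately show ?thesis
    unfolding \<alpha>_def[symmetric]
    by (auto simp: ring_of_integers_def intro!: algebraic_int_closed \<alpha>)
qed

text \<open>
  Let \<open>x = a + b s\<close> be integral, with conjugate \<open>x'\<close> and norm \<open>N = a\<^sup>2 - s\<^sup>2 b\<^sup>2\<close>, and write
  \<open>s\<^sup>2 = 2 \<epsilon>\<close> with \<open>\<epsilon> = \<plusminus>1\<close>. Unramifiedness at \<open>2\<close> is used three times, on
  \<open>2 (2 b)\<^sup>2 = \<epsilon> (x - x')\<^sup>2\<close>, on \<open>2 a\<^sup>2 = 2 N + \<epsilon> (2 b)\<^sup>2\<close> and on \<open>2 b\<^sup>2 = \<epsilon> (a\<^sup>2 - N)\<close>, to get the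
  integrality of \<open>2 b\<close>, of \<open>a\<close> and finally of \<open>b\<close>.
\<close>

lemma ring_of_integers_adjoin_sqrt_two:
  assumes two: "unramified_at K 2" and s: "s\<^sup>2 = of_int m" "s \<notin> K" and m: "m \<in> {2, -2}"
  shows "ring_of_integers (adjoin s) =
    {a + b * s | a b. a \<in> ring_of_integers K \<and> b \<in> ring_of_integers K}"
proof -
  have s_int: "algebraic_int s"
    by - (rule algebraic_int_of_square, simp add: s)
  obtain \<epsilon> :: complex where \<epsilon>: "\<epsilon> = 1 \<or> \<epsilon> = -1" "s\<^sup>2 = 2 * \<epsilon>"
    using m s(1) by force
  have \<epsilon>': "algebraic_int \<epsilon>" "\<epsilon>\<^sup>2 = 1" using \<epsilon>(1) by auto
  have "a \<in> ring_of_integers K \<and> b \<in> ring_of_integers K"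
    if ab: "a \<in> K" "b \<in> K" and x: "algebraic_int (a + b * s)" for a b
  proof -
    have x': "algebraic_int (a - b * s)"
      using ab s x by (intro algebraic_int_conjugate) (auto intro: closed)
    define N where "N = a\<^sup>2 - 2 * \<epsilon> * b\<^sup>2"
    have "N = (a + b * s) * (a - b * s)"
      by (simp add: N_def flip: \<epsilon>(2)) (simp add: power2_eq_square algebra_simps)
    hence N: "algebraic_int N"
      by (simp only: algebraic_int_closed x x')
    have "2 * (2 * b)\<^sup>2 = \<epsilon> * ((a + b * s) - (a - b * s))\<^sup>2"
      using \<epsilon>'(2) by (simp add: power_mult_distrib \<epsilon>(2)) (simp add: power2_eq_square)
    hence "algebraic_int (of_int 2 * (2 * b)\<^sup>2)"
      by (simp only: algebraic_int_closed x x' \<epsilon>' of_int_numeral)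
    hence b2: "algebraic_int (2 * b)"
      using ab by - (rule unramified_atD[OF two], auto intro: closed)
    have "2 * a\<^sup>2 = 2 * N + \<epsilon> * (2 * b)\<^sup>2"
      by (simp add: N_def power_mult_distrib algebra_simps)
    hence "algebraic_int (of_int 2 * a\<^sup>2)"
      by (simp only: algebraic_int_closed b2 N \<epsilon>' of_int_numeral algebraic_int_numeral)
    hence a: "algebraic_int a"
      using ab by - (rule unramified_atD[OF two])
    have "2 * b\<^sup>2 = \<epsilon> * (a\<^sup>2 - N)"
      using \<epsilon>'(2) by (simp add: N_def power2_eq_square)
    hence "algebraic_int (of_int 2 * b\<^sup>2)"
      by (simp only: algebraic_int_closed a N \<epsilon>' of_int_numeral)
    hence "algebraic_int b"
      using ab by - (rule unramified_atD[OF two])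
    thus ?thesis using a ab by (simp add: ring_of_integers_def)
  qed
  thus ?thesis
    by (auto simp: ring_of_integers_def adjoin_def intro!: algebraic_int_closed s_int)
qed

end


definition free_of_rank_two ::
    "complex set \<Rightarrow> complex \<Rightarrow> complex \<Rightarrow> complex set \<Rightarrow> bool" where
  "free_of_rank_two R x y R' \<longleftrightarrow>
     R' = {a * x + b * y | a b. a \<in> R \<and> b \<in> R} \<and>
     (\<forall>a\<in>R. \<forall>b\<in>R. a * x + b * y = 0 \<longrightarrow> a = 0 \<and> b = 0)"

lemma (in complex_subfield) ring_of_integers_add:
  "a \<in> ring_of_integers K \<Longrightarrow> b \<in> ring_of_integers K \<Longrightarrow> a + b \<in> ring_of_integers K"
  by (simp add: ring_of_integers_def closed algebraic_int_add)

lemma (in complex_subfield) ring_of_integers_diff: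
  "a \<in> ring_of_integers K \<Longrightarrow> b \<in> ring_of_integers K \<Longrightarrow> a - b \<in> ring_of_integers K"
  by (simp add: ring_of_integers_def closed algebraic_int_diff)

text \<open>
  The change of basis \<open>1 = x + (1 - x)\<close> is unimodular. For \<open>x = (1 + \<surd>d) / 2\<close> the new basis consists
  of \<open>x\<close> and its conjugate, which is what the second family of the theorem is built from.
\<close>

lemma (in complex_subfield) free_of_rank_two_conjugates:
  assumes "free_of_rank_two (ring_of_integers K) 1 x R'"
  shows "free_of_rank_two (ring_of_integers K) x (1 - x) R'"
proof -
  let ?R = "ring_of_integers K"
  have eq: "a * x + b * (1 - x) = b * 1 + (a - b) * x" for a b
    by (simp add: algebra_simps)
  have "\<exists>a' b'. a * 1 + b * x = a' * x + b' * (1 - x) \<and> a' \<in> ?R \<and> b' \<in> ?R"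
    if "a \<in> ?R" "b \<in> ?R" for a b
    using that by (intro exI[of _ "a + b"] exI[of _ a])
      (auto simp: ring_of_integers_add algebra_simps)
  moreover have "\<exists>a' b'. a * x + b * (1 - x) = a' * 1 + b' * x \<and> a' \<in> ?R \<and> b' \<in> ?R"
    if "a \<in> ?R" "b \<in> ?R" for a b
    using that eq ring_of_integers_diff by blast
  ultimately have
    "{a * 1 + b * x | a b. a \<in> ?R \<and> b \<in> ?R} = {a * x + b * (1 - x) | a b. a \<in> ?R \<and> b \<in> ?R}"
    by blast
  moreover have "a = 0 \<and> b = 0"
    if "a \<in> ?R" "b \<in> ?R" "a * x + b * (1 - x) = 0" for a b
  proof -
    have "b = 0 \<and> a - b = 0"
      using assms that ring_of_integers_diff[of a b] unfolding free_of_rank_two_def eq by blast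
    thus ?thesis by simp
  qed
  ultimately show ?thesis
    using assms unfolding free_of_rank_two_def by blast
qed


section \<open>Integral bases of towers\<close>

text \<open>
  Sums over the index set are easier to split than sums over its image; injectivity comes for free,
  since a repeated member would be a relation with coefficients \<open>1\<close> and \<open>-1\<close>.
\<close>

lemma is_int_basis_iff:
  assumes "finite I"
  shows "is_int_basis I b M \<longleftrightarrow>
    (\<forall>c :: 'i \<Rightarrow> int. (\<Sum>i\<in>I. of_int (c i) * b i) = 0 \<longrightarrow> (\<forall>i\<in>I. c i = 0)) \<and>
    M = range (\<lambda>c :: 'i \<Rightarrow> int. \<Sum>i\<in>I. of_int (c i) * b i)" (is "?L \<longleftrightarrow> ?ind \<and> ?span")
proof -
  have fin: "finite (b ` I)" using assms by simp
  have inj: "inj_on b I" if ?ind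
  proof (rule inj_onI, rule ccontr)
    fix i j assume ij: "i \<in> I" "j \<in> I" "b i = b j" "i \<noteq> j"
    define c where "c = (\<lambda>k. if k = i then 1 else if k = j then - 1 else (0 :: int))"
    have "(\<Sum>k\<in>I. of_int (c k) * b k) = (\<Sum>k\<in>{i, j}. of_int (c k) * b k)"
      using ij assms by (intro sum.mono_neutral_right) (auto simp: c_def)
    also have "\<dots> = 0" using ij by (simp add: c_def)
    finally have "c i = 0" using that ij by blast
    thus False by (simp add: c_def)
  qed
  have "int_module.independent (b ` I) \<longleftrightarrow> ?ind" if "inj_on b I"
  proof -
    have reindex: "(\<Sum>v\<in>b ` I. of_int (u v) * v) = (\<Sum>i\<in>I. of_int (u (b i)) * b i)" for u :: "complex \<Rightarrow> int"
      using that by (simp add: sum.reindex)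
    show ?thesis
    proof
      assume ind: "int_module.independent (b ` I)"
      show ?ind
      proof (intro allI impI ballI)
        fix c :: "'i \<Rightarrow> int" and i assume c: "(\<Sum>i\<in>I. of_int (c i) * b i) = 0" and "i \<in> I"
        define u where "u = c \<circ> the_inv_into I b"
        have u: "u (b i) = c i" if "i \<in> I" for i
          using that \<open>inj_on b I\<close> by (simp add: u_def the_inv_into_f_f)
        have "(\<Sum>v\<in>b ` I. of_int (u v) * v) = 0"
          unfolding reindex using c u by simp
        hence "u (b i) = 0"
          using ind \<open>i \<in> I\<close> unfolding int_module.dependent_finite[OF fin] by blast
        thus "c i = 0" using u \<open>i \<in> I\<close> by simp
      qed
    next
      assume ?ind
      thus "int_module.independent (b ` I)"
        unfolding int_module.dependent_finite[OF fin] reindex by force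
    qed
  qed
  moreover have "int_module.span (b ` I) = range (\<lambda>c :: 'i \<Rightarrow> int. \<Sum>i\<in>I. of_int (c i) * b i)"
    if "inj_on b I"
  proof -
    have "(\<Sum>i\<in>I. of_int (c i) * b i) \<in> int_module.span (b ` I)" for c :: "'i \<Rightarrow> int"
      by (intro int_module.span_sum int_module.span_scale int_module.span_base) auto
    moreover have "\<exists>c :: 'i \<Rightarrow> int. (\<Sum>v\<in>b ` I. of_int (u v) * v) = (\<Sum>i\<in>I. of_int (c i) * b i)"
      for u :: "complex \<Rightarrow> int"
      using that by (intro exI[of _ "u \<circ> b"]) (simp add: sum.reindex)
    ultimately show ?thesis
      unfolding int_module.span_finite[OF fin] by (intro equalityI subsetI) blast+
  qed
  ultimately show ?thesis
    using inj unfolding is_int_basis_def by blast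
qed

lemma sum_PiE_insert_binary:
  fixes f :: "(nat \<Rightarrow> nat) \<Rightarrow> 'a :: comm_monoid_add"
  assumes "n \<notin> I"
  shows "(\<Sum>s\<in>insert n I \<rightarrow>\<^sub>E {0, 1}. f s) =
    (\<Sum>s\<in>I \<rightarrow>\<^sub>E {0, 1}. f (s(n := 0))) + (\<Sum>s\<in>I \<rightarrow>\<^sub>E {0, 1}. f (s(n := 1)))"
proof -
  have "(\<Sum>s\<in>insert n I \<rightarrow>\<^sub>E {0, 1}. f s) =
    (\<Sum>(k, s)\<in>{0, 1} \<times> (I \<rightarrow>\<^sub>E {0, 1}). f (s(n := k)))"
    unfolding PiE_insert_eq using inj_combinator[OF assms, of "\<lambda>_. {0, 1 :: nat}"]
    by (subst sum.reindex) (auto simp: case_prod_unfold intro!: sum.cong)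
  thus ?thesis
    by (simp flip: sum.cartesian_product)
qed

text \<open>
  The coefficients with respect to the product family are the coefficients, with respect to the
  basis of \<open>R\<close>, of the two \<open>R\<close>-coordinates of an element of \<open>R'\<close>. Two arbitrary values \<open>\<beta> i 0\<close> and
  \<open>\<beta> i 1\<close> at each level, instead of powers of one element, serve both families of the theorem.
\<close>

lemma is_int_basis_tower:
  fixes \<beta> :: "nat \<Rightarrow> nat \<Rightarrow> complex"
  assumes "finite I" "n \<notin> I"
    and basis: "is_int_basis (I \<rightarrow>\<^sub>E {0, 1}) (\<lambda>s. \<Prod>i\<in>I. \<beta> i (s i)) R"
    and free: "free_of_rank_two R (\<beta> n 0) (\<beta> n 1) R'"
  shows "is_int_basis (insert n I \<rightarrow>\<^sub>E {0, 1}) (\<lambda>s. \<Prod>i\<in>insert n I. \<beta> i (s i)) R'"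
proof -
  let ?E = "I \<rightarrow>\<^sub>E {0, 1 :: nat}"
  let ?S = "\<lambda>c :: (nat \<Rightarrow> nat) \<Rightarrow> int. \<Sum>s\<in>?E. of_int (c s) * (\<Prod>i\<in>I. \<beta> i (s i))"
  have fin: "finite ?E" "finite (insert n I \<rightarrow>\<^sub>E {0, 1 :: nat})"
    using assms(1) by (auto intro!: finite_PiE)
  have ind: "\<And>c s. ?S c = 0 \<Longrightarrow> s \<in> ?E \<Longrightarrow> c s = 0" and R: "R = range ?S"
    using basis unfolding is_int_basis_iff[OF fin(1)] by blast+
  have R': "R' = {a * \<beta> n 0 + b * \<beta> n 1 | a b. a \<in> R \<and> b \<in> R}"
    and free0: "\<And>a b. a \<in> R \<Longrightarrow> b \<in> R \<Longrightarrow> a * \<beta> n 0 + b * \<beta> n 1 = 0 \<Longrightarrow> a = 0 \<and> b = 0"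
    using free unfolding free_of_rank_two_def by blast+
  have prod: "(\<Prod>i\<in>I. \<beta> i ((s(n := k)) i)) = (\<Prod>i\<in>I. \<beta> i (s i))" for s k
    using assms(2) by (intro prod.cong) auto
  have sum: "(\<Sum>s\<in>insert n I \<rightarrow>\<^sub>E {0, 1}. of_int (c s) * (\<Prod>i\<in>insert n I. \<beta> i (s i))) =
    ?S (\<lambda>s. c (s(n := 0))) * \<beta> n 0 + ?S (\<lambda>s. c (s(n := 1))) * \<beta> n 1" for c
    unfolding sum_PiE_insert_binary[OF assms(2)]
    unfolding prod.insert[OF assms(1,2)] prod fun_upd_same sum_distrib_right
    by (simp add: mult_ac)
  show ?thesis
    unfolding is_int_basis_iff[OF fin(2)] sum
  proof (intro conjI allI impI ballI)
    fix c :: "(nat \<Rightarrow> nat) \<Rightarrow> int" and s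
    assume 0: "?S (\<lambda>s. c (s(n := 0))) * \<beta> n 0 + ?S (\<lambda>s. c (s(n := 1))) * \<beta> n 1 = 0"
      and s: "s \<in> insert n I \<rightarrow>\<^sub>E {0, 1 :: nat}"
    have zero: "?S (\<lambda>s. c (s(n := 0))) = 0 \<and> ?S (\<lambda>s. c (s(n := 1))) = 0"
      using 0 by (intro free0) (auto simp: R)
    obtain k :: nat and t where "s = t(n := k)" "t \<in> ?E" "k = 0 \<or> k = 1"
      using s unfolding PiE_insert_eq by auto
    thus "c s = 0"
      using ind[of "\<lambda>s. c (s(n := k))" t] zero by auto
  next
    let ?T = "\<lambda>c. ?S (\<lambda>s. c (s(n := 0))) * \<beta> n 0 + ?S (\<lambda>s. c (s(n := 1))) * \<beta> n 1"
    show "R' = range ?T"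
    proof (intro equalityI subsetI)
      fix x assume "x \<in> R'"
      then obtain c0 c1 where x: "x = ?S c0 * \<beta> n 0 + ?S c1 * \<beta> n 1"
        by (auto simp: R' R)
      \<comment> \<open>restoring the value \<open>undefined\<close> at \<open>n\<close> brings an extended index back to an index over \<open>I\<close>\<close>
      define c where "c s = (if s n = 0 then c0 else c1) (s(n := undefined))" for s
      have "c (s(n := 0)) = c0 s" "c (s(n := 1)) = c1 s" if "s \<in> ?E" for s
      proof -
        have "s(n := undefined) = s" using that assms(2) by (auto simp: PiE_def extensional_def)
        thus "c (s(n := 0)) = c0 s" "c (s(n := 1)) = c1 s" by (simp_all add: c_def)
      qed
      hence "x = ?T c" unfolding x by simp
      thus "x \<in> range ?T" by (rule range_eqI[of x ?T c])
    next
      fix x assume "x \<in> range ?T"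
      then obtain c where "x = ?T c" by (rule rangeE)
      thus "x \<in> R'"
        unfolding R' R by (intro CollectI exI conjI, assumption) (rule rangeI)+
    qed
  qed
qed

lemma is_int_basis_tower_chain:
  fixes \<beta> :: "nat \<Rightarrow> nat \<Rightarrow> complex"
  assumes "R 1 = \<int>"
    and "\<And>n. n \<in> {1..r} \<Longrightarrow> free_of_rank_two (R n) (\<beta> n 0) (\<beta> n 1) (R (Suc n))"
  shows "is_int_basis ({1..r} \<rightarrow>\<^sub>E {0, 1}) (\<lambda>s. \<Prod>i\<in>{1..r}. \<beta> i (s i)) (R (Suc r))"
  using assms(2)
proof (induction r)
  case 0
  show ?case
    using assms(1) by (simp add: is_int_basis_iff) (auto simp: Ints_def)
next
  case (Suc r)
  have "{1..Suc r} = insert (Suc r) {1..r}" by auto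
  thus ?case
    using is_int_basis_tower[of "{1..r}" "Suc r" \<beta> "R (Suc r)" "R (Suc (Suc r))"] Suc by simp
qed

section \<open>Integral bases of multiquadratic fields\<close>

theorem theorem7:
  fixes r :: nat
    and q :: "nat \<Rightarrow> int"
    and sq \<alpha> \<alpha>' :: "nat \<Rightarrow> complex"
  assumes "r \<ge> 1"
    and "inj_on q {1..<r}"
    and "\<And>i. i \<in> {1..<r} \<Longrightarrow>
           Factorial_Ring.prime \<bar>q i\<bar> \<and> odd \<bar>q i\<bar> \<and> [q i = 1] (mod 4)"
    and "q r \<in> {8, -8}"
    and "\<And>i. i \<in> {1..r} \<Longrightarrow> (sq i)\<^sup>2 = of_int (q i)"
    and "\<And>i. i \<in> {1..<r} \<Longrightarrow> \<alpha> i = (1 + sq i) / 2"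
    and "\<And>i. i \<in> {1..<r} \<Longrightarrow> \<alpha>' i = (1 - sq i) / 2"
    and "(\<alpha> r)\<^sup>2 = of_int (q r) / 4"
  shows "is_int_basis ({1..r} \<rightarrow>\<^sub>E {0, 1 :: nat})
           (\<lambda>s. \<Prod>i\<in>{1..r}. \<alpha> i ^ s i)
           (ring_of_integers (rat_adjoin (sq ` {1..r}))) \<and>
         is_int_basis ({1..r} \<rightarrow>\<^sub>E {0, 1 :: nat})
           (\<lambda>s. (\<Prod>i\<in>{1..<r}. \<alpha>' i ^ s i * \<alpha> i ^ (1 - s i)) * \<alpha> r ^ s r)
           (ring_of_integers (rat_adjoin (sq ` {1..r})))"
proof -
  \<comment> \<open>the field below level \<open>n\<close>, so that \<open>sq n\<close> generates \<open>K (Suc n)\<close> over \<open>K n\<close>\<close>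
  define K where "K n = rat_adjoin (sq ` {1..<n})" for n
  have K: "complex_subfield (K n)" for n
    unfolding K_def by (rule complex_subfield_rat_adjoin)
  have K1: "K 1 = \<rat>" by (simp add: K_def rat_adjoin_empty)
  have K_Suc: "K (Suc n) = complex_subfield.adjoin (K n) (sq n)" if n: "n \<in> {1..r}" for n
  proof -
    interpret complex_subfield "K n" by (rule K)
    have "{1..<Suc n} = insert n {1..<n}" using n by auto
    moreover have "(sq n)\<^sup>2 \<in> K n" using assms(5)[OF n] by (simp add: closed)
    ultimately show ?thesis
      unfolding K_def by (simp add: rat_adjoin_insert)
  qed
  have coprime: "coprime (q i) (q j)" if "i \<in> {1..<r}" "j \<in> {1..<r}" "i \<noteq> j" for i j
  proof -
    have "\<bar>q i\<bar> \<noteq> \<bar>q j\<bar>"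
    proof
      assume "\<bar>q i\<bar> = \<bar>q j\<bar>"
      moreover have "q i \<noteq> q j" using assms(2) that by (auto dest: inj_onD)
      moreover have "q i mod 4 = 1" "q j mod 4 = 1"
        using assms(3)[OF that(1)] assms(3)[OF that(2)] by (auto simp: cong_def)
      ultimately show False by presburger
    qed
    hence "coprime \<bar>q i\<bar> \<bar>q j\<bar>"
      using assms(3) that by (intro primes_coprime) auto
    thus ?thesis by simp
  qed
  have unit: "\<not> q i dvd 1" "q i \<noteq> 0" if "i \<in> {1..<r}" for i
    using assms(3)[OF that] by (auto simp: prime_def)
  have notin: "sq n \<notin> K n" if "n \<in> {1..<r}" "unramified_at (K n) (q n)" for n
    using complex_subfield.sqrt_not_in_if_unramified[OF K that(2) unit[OF that(1)]]
      assms(5)[of n] that(1) by simp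
  have unram: "unramified_at (K n) p"
    if "n \<ge> 1" "n \<le> r" "prime_elem p" "\<And>i. i \<in> {1..<n} \<Longrightarrow> coprime p (q i)" for n p
    using that
  proof (induction n arbitrary: p rule: nat_induct_at_least)
    case base
    thus ?case using unramified_at_Rats by (simp add: K1[simplified])
  next
    case (Suc n)
    have n: "n \<in> {1..<r}" using Suc.hyps Suc.prems by simp
    have "prime_elem (q n)" using assms(3)[OF n] by (simp add: prime_def)
    hence d: "unramified_at (K n) (q n)"
      using n coprime by (intro Suc.IH) auto
    have "unramified_at (complex_subfield.adjoin (K n) (sq n)) p"
      using n notin[OF n d] Suc.prems Suc.IH[of p] assms(3)[OF n] assms(5)[of n]
      by (intro complex_subfield.unramified_at_adjoin[OF K d, of p]) auto
    thus ?case using K_Suc[of n] n by simp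
  qed
  have free_odd: "free_of_rank_two (ring_of_integers (K n)) 1 (\<alpha> n) (ring_of_integers (K (Suc n)))"
    if n: "n \<in> {1..<r}" for n
  proof -
    interpret complex_subfield "K n" by (rule K)
    have "prime_elem (q n)" using assms(3)[OF n] by (simp add: prime_def)
    hence d: "unramified_at (K n) (q n)"
      using n coprime by (intro unram) auto
    note s = assms(5)[of n] notin[OF n d]
    have "a = 0 \<and> b = 0" if ab: "a \<in> K n" "b \<in> K n" "a * 1 + b * \<alpha> n = 0" for a b
    proof -
      have "(a + b / 2) + (b / 2) * sq n = a * 1 + b * \<alpha> n"
        by (simp add: assms(6)[OF n] distrib_left add_divide_distrib)
      hence "a + b / 2 = 0 \<and> b / 2 = 0"
        using ab(1,2) unfolding ab(3)
        by (intro adjoin_independent[OF s(2)]) (auto intro: divide_closed add_closed numeral_closed)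
      thus ?thesis by auto
    qed
    moreover have "ring_of_integers (K (Suc n)) =
        {a * 1 + b * \<alpha> n | a b. a \<in> ring_of_integers (K n) \<and> b \<in> ring_of_integers (K n)}"
      using ring_of_integers_adjoin_odd[OF d, of "sq n"] s n assms(3)[OF n] K_Suc[of n]
      by (simp add: assms(6)[OF n])
    ultimately show ?thesis
      unfolding free_of_rank_two_def by (auto simp: ring_of_integers_def)
  qed
  have free_two: "free_of_rank_two (ring_of_integers (K r)) 1 (\<alpha> r) (ring_of_integers (K (Suc r)))"
  proof -
    interpret complex_subfield "K r" by (rule K)
    define m where "m = q r div 4"
    have m: "m \<in> {2, -2}" "q r = 4 * m" using assms(4) by (auto simp: m_def)
    have \<alpha>2: "(\<alpha> r)\<^sup>2 = of_int m" using assms(8) m by simp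
    have two: "unramified_at (K r) 2"
      using assms(1,3) by (intro unram) auto
    hence "unramified_at (K r) m"
      using m(1) unramified_at_minus[of "K r" 2] by auto
    hence \<alpha>: "\<alpha> r \<notin> K r"
      using m(1) \<alpha>2 by (intro sqrt_not_in_if_unramified) auto
    \<comment> \<open>the two square roots are chosen independently, so they may differ in sign\<close>
    have "(sq r)\<^sup>2 = (2 * \<alpha> r)\<^sup>2"
      using assms(5)[of r] assms(1) \<alpha>2 m(2) by (simp add: power_mult_distrib)
    hence "sq r = 2 * \<alpha> r \<or> sq r = - 2 * \<alpha> r"
      unfolding power2_eq_iff by simp
    hence "K (Suc r) = adjoin (\<alpha> r)"
      using K_Suc[of r] assms(1) adjoin_scale[of 2 "\<alpha> r"] adjoin_scale[of "- 2" "\<alpha> r"]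
      by (auto simp: closed)
    hence "ring_of_integers (K (Suc r)) =
        {a * 1 + b * \<alpha> r | a b. a \<in> ring_of_integers (K r) \<and> b \<in> ring_of_integers (K r)}"
      using ring_of_integers_adjoin_sqrt_two[OF two \<alpha>2 \<alpha> m(1)] by simp
    thus ?thesis
      using adjoin_independent[OF \<alpha>]
      unfolding free_of_rank_two_def by (auto simp: ring_of_integers_def)
  qed
  have ring1: "ring_of_integers (K 1) = \<int>"
    unfolding K1 ring_of_integers_def
    using rational_algebraic_int_is_int Ints_subset_Rats by (auto intro: int_imp_algebraic_int)
  have Kr: "K (Suc r) = rat_adjoin (sq ` {1..r})"
    by (simp add: K_def atLeastLessThanSuc_atLeastAtMost)
  have "is_int_basis ({1..r} \<rightarrow>\<^sub>E {0, 1}) (\<lambda>s. \<Prod>i\<in>{1..r}. \<alpha> i ^ s i)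
      (ring_of_integers (K (Suc r)))"
    using free_odd free_two
    by (intro is_int_basis_tower_chain[of "\<lambda>n. ring_of_integers (K n)" r "\<lambda>i k. \<alpha> i ^ k"] ring1)
      (auto simp: le_less)
  moreover have "is_int_basis ({1..r} \<rightarrow>\<^sub>E {0, 1})
      (\<lambda>s. (\<Prod>i\<in>{1..<r}. \<alpha>' i ^ s i * \<alpha> i ^ (1 - s i)) * \<alpha> r ^ s r)
      (ring_of_integers (K (Suc r)))"
  proof -
    define \<beta> where "\<beta> i k = (if i < r then \<alpha>' i ^ k * \<alpha> i ^ (1 - k) else \<alpha> i ^ k)" for i k :: nat
    have "free_of_rank_two (ring_of_integers (K n)) (\<beta> n 0) (\<beta> n 1) (ring_of_integers (K (Suc n)))"
      if n: "n \<in> {1..r}" for n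
    proof (cases "n < r")
      case True
      have "\<alpha> n = (1 + sq n) / 2" "\<alpha>' n = (1 - sq n) / 2"
        using n True assms(6,7)[of n] by simp_all
      hence "\<alpha>' n = 1 - \<alpha> n"
        by (simp only:) (simp add: field_simps)
      thus ?thesis
        using complex_subfield.free_of_rank_two_conjugates[OF K free_odd] n True
        by (simp add: \<beta>_def)
    next
      case False
      thus ?thesis using free_two n by (simp add: \<beta>_def)
    qed
    from is_int_basis_tower_chain[of "\<lambda>n. ring_of_integers (K n)", OF ring1 this]
    have "is_int_basis ({1..r} \<rightarrow>\<^sub>E {0, 1}) (\<lambda>s. \<Prod>i\<in>{1..r}. \<beta> i (s i))
      (ring_of_integers (K (Suc r)))" by simp
    moreover have "(\<Prod>i\<in>{1..r}. \<beta> i (s i)) =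
        (\<Prod>i\<in>{1..<r}. \<alpha>' i ^ s i * \<alpha> i ^ (1 - s i)) * \<alpha> r ^ s r" for s
    proof -
      have "{1..r} = insert r {1..<r}" using assms(1) by auto
      thus ?thesis by (simp add: \<beta>_def mult.commute)
    qed
    ultimately show ?thesis by simp
  qed
  ultimately show ?thesis
    unfolding Kr ..
qed

end
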